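(* Assume that for every $y\in\mathcal Y$ the function $f(\cdot,y)$ is convex on $\mathcal X$ (no concavity of $f(x,\cdot)$ is assumed) and that $f$ satisfies the Lipschitz gradient assumption with constants $L_{11},L_{12},L_{21},L_{22}>0$. Let $\{q_k\}_{k\ge1}$ be a positive monotonically decreasing sequence, let $\bar\zeta,\bar\nu>0$ be constants, $\{\bar\gamma_k\}_{k\ge1}$ real numbers, and let $\{(x_k,y_k)\}_{k\ge1}$ be generated from $(x_1,y_1)\in\mathcal X\times\mathcal Y$ by $$x_{k+1}=\mathcal P_{\mathcal X}\big(x_k-\bar\zeta\nabla_xf(x_k,y_k)-\bar\zeta q_kx_k\big),\qquad y_{k+1}=\mathcal P_{\mathcal Y}\Big(y_k+\tfrac1{\bar\nu+\bar\gamma_k}\nabla_yf(x_{k+1},y_k)\Big),\quad k\ge1.$$ Put $L_{11}'=L_{11}+q_1$ and, for $k\ge1$, $$\hat{\mathcal S}_{k+1}=-\frac8{\bar\zeta^2q_{k+1}}\|x_{k+1}-x_k\|^2-\frac8{\bar\zeta}\Big(1-\frac{q_k}{q_{k+1}}\Big)\|x_{k+1}\|^2,$$ $$\hat{\mathcal F}_{k+1}=f(x_{k+1},y_{k+1})+\hat{\mathcal S}_{k+1}+\frac{15}{2\bar\zeta}\|x_{k+1}-x_k\|^2+\frac{q_k}{2}\|x_{k+1}\|^2-\Big(\frac{\bar\zeta L_{21}^2}{2}+\frac{16L_{21}^2}{\bar\zeta q_{k+1}^2}\Big)\|y_{k+1}-y_k\|^2 .$$ If for all $k$ $$\bar\gamma_k>L_{22},\qquad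 \frac1{q_{k+1}}-\frac1{q_k}\le\frac{\bar\zeta}{5},\qquad \bar\zeta\le\frac2{L_{11}'+q_1},$$ then for all $k\ge2$, $$\hat{\mathcal F}_{k+1}-\hat{\mathcal F}_k\ge\Big(\bar\nu+\frac{\bar\gamma_k}{2}-\frac{\bar\zeta L_{21}^2}{2}-\frac{16L_{21}^2}{\bar\zeta q_{k+1}^2}\Big)\|y_{k+1}-y_k\|^2+\frac{q_k-q_{k-1}}{2}\|x_{k+1}\|^2+\frac9{10\bar\zeta}\|x_{k+1}-x_k\|^2+\frac8{\bar\zeta}\Big(\frac{q_k}{q_{k+1}}-\frac{q_{k-1}}{q_k}\Big)\|x_{k+1}\|^2 .$$
   Context: $\mathcal X\subseteq\mathbb R^n$ and $\mathcal Y\subseteq\mathbb R^m$ are nonempty closed bounded convex sets and $f:\mathcal X\times\mathcal Y\to\mathbb R$ is a smooth function. $\|\cdot\|$ is the Euclidean norm; $\mathcal P_{\mathcal X},\mathcal P_{\mathcal Y}$ are Euclidean projections. Lipschitz gradient assumption: for all $x,\bar x\in\mathcal X$, $y,\bar y\in\mathcal Y$: $\|\nabla_xf(x,y)-\nabla_xf(\bar x,y)\|\le L_{11}\|x-\bar x\|$, $\|\nabla_xf(x,y)-\nabla_xf(x,\bar y)\|\le L_{21}\|y-\bar y\|$, $\|\nabla_yf(x,y)-\nabla_yf(x,\bar y)\|\le L_{22}\|y-\bar y\|$, $\|\nabla_yf(x,y)-\nabla_yf(\bar x,y)\|\le L_{12}\|x-\bar x\|$. *)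

theory Defs
  imports "HOL-Analysis.Analysis"
begin

definition gradient :: "('a::euclidean_space \<Rightarrow> real) \<Rightarrow> 'a \<Rightarrow> 'a"
  where "gradient g x = (THE d. GDERIV g x :> d)"

lemma gradient_eqI:
  assumes "GDERIV g x :> d"
  shows "gradient g x = d"
  unfolding gradient_def
proof (rule the_equality, fact assms)
  fix e assume "GDERIV g x :> e"
  with assms have "(\<lambda>h. inner h d) = (\<lambda>h. inner h e)"
    unfolding gderiv_def by (rule has_derivative_unique)
  then show "e = d"
    by (metis vector_eq_ldot)
qed

definition grad_x :: "('a::euclidean_space \<Rightarrow> 'b::euclidean_space \<Rightarrow> real) \<Rightarrow> 'a \<Rightarrow> 'b \<Rightarrow> 'a"
  where "grad_x f x y = gradient (\<lambda>u. f u y) x"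

definition grad_y :: "('a::euclidean_space \<Rightarrow> 'b::euclidean_space \<Rightarrow> real) \<Rightarrow> 'a \<Rightarrow> 'b \<Rightarrow> 'b"
  where "grad_y f x y = gradient (\<lambda>v. f x v) y"

(* Smooth means continuously differentiable, as usual in optimization; smoothness of a function
   on a closed set S is smoothness on some open neighbourhood of S, so that the gradient is
   meaningful at boundary points and also when S has empty interior. *)
definition smooth_on_nhd :: "('a::euclidean_space \<Rightarrow> 'b::euclidean_space \<Rightarrow> real) \<Rightarrow> ('a \<times> 'b) set \<Rightarrow> bool"
  where "smooth_on_nhd f S \<longleftrightarrow>
    (\<exists>U (D :: 'a \<times> 'b \<Rightarrow> ('a \<times> 'b) \<Rightarrow>\<^sub>L real). open U \<and> S \<subseteq> U \<and>
       (\<forall>z\<in>U. ((\<lambda>(x, y). f x y) has_derivative blinfun_apply (D z)) (at z)) \<and>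
       continuous_on U D)"

(* L21 bounds the variation of the x-gradient in y, and L12 that of the y-gradient in x. *)
definition lipschitz_gradients ::
  "('a::euclidean_space \<Rightarrow> 'b::euclidean_space \<Rightarrow> real) \<Rightarrow> 'a set \<Rightarrow> 'b set \<Rightarrow>
    real \<Rightarrow> real \<Rightarrow> real \<Rightarrow> real \<Rightarrow> bool"
  where "lipschitz_gradients f X Y L11 L12 L21 L22 \<longleftrightarrow>
    (\<forall>x\<in>X. \<forall>x'\<in>X. \<forall>y\<in>Y. \<forall>y'\<in>Y.
       norm (grad_x f x y - grad_x f x' y) \<le> L11 * norm (x - x') \<and>
       norm (grad_x f x y - grad_x f x y') \<le> L21 * norm (y - y') \<and>
       norm (grad_y f x y - grad_y f x y') \<le> L22 * norm (y - y') \<and>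
       norm (grad_y f x y - grad_y f x' y) \<le> L12 * norm (x - x'))"

end

theory Submission imports Defs begin

text \<open>
  Write \<open>d = x\<^sub>k\<^sub>+\<^sub>1 - x\<^sub>k\<close> and \<open>s = x\<^sub>k - x\<^sub>k\<^sub>-\<^sub>1\<close>. The variational inequalities of two consecutive
  projections, tested against each other's endpoint, control \<open>(d - s) \<bullet> d\<close> by the change of the
  regularised gradient. Its part coming from the move \<open>s\<close> at fixed \<open>y\<close> is bounded below by
  \<open>- \<parallel>d - s\<parallel>\<^sup>2 / (2 \<zeta>)\<close> up to favourable terms, exactly what the projection inequality compensates;
  \<open>8 / (\<zeta>\<^sup>2 q\<^sub>k)\<close> times the result bounds the growth of \<open>S\<close>. Convexity in \<open>x\<close>, the descent lemma in
  \<open>y\<close> and the projection inequalities bound the growth of \<open>f\<close>.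

  Since the gradient is Lipschitz only on \<open>X\<close>, the Baillon-Haddad theorem on the whole space
  does not apply; its consequence needed here is proved on \<open>X\<close> from a local estimate that is
  summed along a segment.
\<close>

section \<open>First-order bounds on a convex set\<close>

lemma GDERIV_comp_segment:
  assumes "GDERIV \<phi> (u + t *\<^sub>R h) :> d"
  shows "((\<lambda>t. \<phi> (u + t *\<^sub>R h)) has_real_derivative d \<bullet> h) (at t)"
proof -
  have 1: "(\<phi> has_derivative (\<lambda>k. k \<bullet> d)) (at (u + t *\<^sub>R h))"
    using assms by (simp add: gderiv_def)
  have 2: "((\<lambda>t. u + t *\<^sub>R h) has_derivative (\<lambda>r. r *\<^sub>R h)) (at t)"
    by (auto intro!: derivative_eq_intros)
  show ?thesis
    using has_derivative_compose[OF 2 1]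
    by (rule has_derivative_imp_has_field_derivative) (simp add: inner_commute)
qed

text \<open>Otherwise \<open>k\<close>, the restriction of \<open>\<phi>\<close> to the segment
  minus the slope of its chord, would increase strictly to the right of 0, while convexity gives
  \<open>k t \<le> k 0\<close> on the unit interval.\<close>

lemma convex_on_gradient_ineq:
  fixes \<phi> :: "'a::euclidean_space \<Rightarrow> real"
  assumes conv: "convex_on X \<phi>" and d: "GDERIV \<phi> u :> d" and u: "u \<in> X" and w: "w \<in> X"
  shows "\<phi> u + d \<bullet> (w - u) \<le> \<phi> w"
proof (rule ccontr)
  assume neg: "\<not> ?thesis"
  define k where "k t = \<phi> (u + t *\<^sub>R (w - u)) - t * (\<phi> w - \<phi> u)" for t
  have "(k has_real_derivative d \<bullet> (w - u) - (\<phi> w - \<phi> u)) (at 0)"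
    unfolding k_def using d
    by (auto intro!: derivative_eq_intros GDERIV_comp_segment)
  moreover have "d \<bullet> (w - u) - (\<phi> w - \<phi> u) > 0"
    using neg by simp
  ultimately obtain e where e: "e > 0" "\<And>h. h > 0 \<Longrightarrow> h < e \<Longrightarrow> k 0 < k h"
    using DERIV_pos_inc_right by (metis add_0)
  define t where "t = min (e / 2) 1"
  have t: "0 < t" "t < e" "t \<le> 1"
    using e(1) by (auto simp: t_def)
  have "\<phi> ((1 - t) *\<^sub>R u + t *\<^sub>R w) \<le> (1 - t) * \<phi> u + t * \<phi> w"
    using conv u w t by (intro convex_onD) auto
  moreover have "(1 - t) *\<^sub>R u + t *\<^sub>R w = u + t *\<^sub>R (w - u)"
    by (simp add: algebra_simps)
  ultimately have "k t \<le> k 0"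
    by (simp add: k_def algebra_simps)
  with e(2)[of t] t show False
    by simp
qed

text \<open>The descent lemma. The gap \<open>k\<close> between \<open>\<phi>\<close> and the
  quadratic model along the segment is nonincreasing, by Cauchy-Schwarz and the Lipschitz bound; the
  latter is applied only at points of the segment, which lie in \<open>X\<close>.\<close>

lemma lipschitz_gradient_upper_bound:
  fixes \<phi> :: "'a::euclidean_space \<Rightarrow> real"
  assumes X: "convex X" and d: "\<And>u. u \<in> X \<Longrightarrow> GDERIV \<phi> u :> g u"
    and lip: "\<And>u v. u \<in> X \<Longrightarrow> v \<in> X \<Longrightarrow> norm (g u - g v) \<le> L * norm (u - v)"
    and u: "u \<in> X" and w: "w \<in> X"
  shows "\<phi> w \<le> \<phi> u + g u \<bullet> (w - u) + L / 2 * (norm (w - u))\<^sup>2"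
proof -
  define h where "h = w - u"
  define k where "k t = \<phi> (u + t *\<^sub>R h) - t * (g u \<bullet> h) - L / 2 * t\<^sup>2 * (norm h)\<^sup>2" for t
  have "k 1 \<le> k 0"
  proof (rule DERIV_nonpos_imp_nonincreasing[where f = k])
    fix t :: real
    assume t: "0 \<le> t" "t \<le> 1"
    have "(1 - t) *\<^sub>R u + t *\<^sub>R w \<in> X"
      using X u w t by (intro convexD) auto
    then have mem: "u + t *\<^sub>R h \<in> X"
      by (simp add: h_def algebra_simps)
    have "(k has_real_derivative
        g (u + t *\<^sub>R h) \<bullet> h - g u \<bullet> h - L * t * (norm h)\<^sup>2) (at t)"
      unfolding k_def using d[OF mem]
      by (auto intro!: derivative_eq_intros GDERIV_comp_segment)
    moreover have "(g (u + t *\<^sub>R h) - g u) \<bullet> h \<le> norm (g (u + t *\<^sub>R h) - g u) * norm h"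
      by (rule norm_cauchy_schwarz)
    moreover have "\<dots> \<le> L * norm (u + t *\<^sub>R h - u) * norm h"
      using lip[OF mem u] by (rule mult_right_mono) simp
    moreover have "\<dots> = L * t * (norm h)\<^sup>2"
      using t by (simp add: power2_eq_square)
    ultimately show "\<exists>y. (k has_real_derivative y) (at t) \<and> y \<le> 0"
      unfolding inner_diff_left
      by (intro exI[of _ "g (u + t *\<^sub>R h) \<bullet> h - g u \<bullet> h - L * t * (norm h)\<^sup>2"] conjI) linarith+
  qed simp
  then show ?thesis
    by (simp add: k_def h_def)
qed

lemma GDERIV_uminus: "GDERIV \<phi> u :> d \<Longrightarrow> GDERIV (\<lambda>u. - \<phi> u) u :> - d"
  unfolding gderiv_def by (auto intro!: derivative_eq_intros)

text \<open>In the variable \<open>y\<close>, where \<open>f\<close> need not be concave, this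
  stands in for a tangent inequality.\<close>

lemma lipschitz_gradient_lower_bound:
  fixes \<phi> :: "'a::euclidean_space \<Rightarrow> real"
  assumes X: "convex X" and d: "\<And>u. u \<in> X \<Longrightarrow> GDERIV \<phi> u :> g u"
    and lip: "\<And>u v. u \<in> X \<Longrightarrow> v \<in> X \<Longrightarrow> norm (g u - g v) \<le> L * norm (u - v)"
    and u: "u \<in> X" and w: "w \<in> X"
  shows "\<phi> w \<ge> \<phi> u + g u \<bullet> (w - u) - L / 2 * (norm (w - u))\<^sup>2"
  using lipschitz_gradient_upper_bound[of X "\<lambda>u. - \<phi> u" "\<lambda>u. - g u" L u w,
      OF X GDERIV_uminus[OF d] _ u w] lip
  by (simp add: norm_minus_commute)

section \<open>Cocoercivity estimates inside \<open>X\<close>\<close>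

text \<open>The tangent at \<open>u\<close> and the quadratic model at \<open>v\<close> are compared
  at \<open>v - e\<close>, the tangent at \<open>v\<close> and the model at \<open>u\<close> at
  \<open>u + e\<close>, and the two are added. The choice \<open>e = (g v - g u) /\<^sub>R L\<close>
  would give cocoercivity, but may leave \<open>X\<close>; hence \<open>e\<close> stays
  free.\<close>

lemma convex_lipschitz_gradient_local:
  fixes \<phi> :: "'a::euclidean_space \<Rightarrow> real"
  assumes X: "convex X" and conv: "convex_on X \<phi>"
    and d: "\<And>u. u \<in> X \<Longrightarrow> GDERIV \<phi> u :> g u"
    and lip: "\<And>u v. u \<in> X \<Longrightarrow> v \<in> X \<Longrightarrow> norm (g u - g v) \<le> L * norm (u - v)"
    and mem: "u \<in> X" "v \<in> X" "u + e \<in> X" "v - e \<in> X"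
  shows "2 * ((g v - g u) \<bullet> e) - L * (norm e)\<^sup>2 \<le> (g v - g u) \<bullet> (v - u)"
proof -
  note low = convex_on_gradient_ineq[OF conv d]
  note up = lipschitz_gradient_upper_bound[OF X d lip]
  have "\<phi> u + g u \<bullet> (v - e - u) \<le> \<phi> v + g v \<bullet> (v - e - v) + L / 2 * (norm (v - e - v))\<^sup>2"
    using low[of u "v - e"] up[of v "v - e"] mem by simp
  moreover have "\<phi> v + g v \<bullet> (u + e - v) \<le> \<phi> u + g u \<bullet> (u + e - u) + L / 2 * (norm (u + e - u))\<^sup>2"
    using low[of v "u + e"] up[of u "u + e"] mem by simp
  ultimately show ?thesis
    by (simp add: inner_diff_left inner_diff_right inner_add_right algebra_simps)
qed

text \<open>Cutting the segment into \<open>N\<close> pieces shrinks the excursions \<open>\<plusminus>e\<close> by the factor \<open>N\<close> without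
  changing the inequality: both sides of the local estimate scale by \<open>1 / N\<close> on each piece.\<close>

lemma convex_lipschitz_gradient_segment:
  fixes \<phi> :: "'a::euclidean_space \<Rightarrow> real"
  assumes X: "convex X" and conv: "convex_on X \<phi>"
    and d: "\<And>u. u \<in> X \<Longrightarrow> GDERIV \<phi> u :> g u"
    and lip: "\<And>u v. u \<in> X \<Longrightarrow> v \<in> X \<Longrightarrow> norm (g u - g v) \<le> L * norm (u - v)"
    and N: "N > 0"
    and mem: "\<And>w. w \<in> closed_segment u v \<Longrightarrow>
      w \<in> X \<and> w + (1 / real N) *\<^sub>R e \<in> X \<and> w - (1 / real N) *\<^sub>R e \<in> X"
  shows "2 * ((g v - g u) \<bullet> e) - L * (norm e)\<^sup>2 \<le> (g v - g u) \<bullet> (v - u)"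
proof -
  define c where "c = 1 / real N"
  have c: "c > 0" "real N * c = 1"
    using N by (auto simp: c_def)
  define p where "p i = u + (real i * c) *\<^sub>R (v - u)" for i
  have seg: "p i \<in> closed_segment u v" if "i \<le> N" for i
    using that N unfolding closed_segment_def
    by (auto intro!: exI[of _ "real i * c"] simp: p_def c_def algebra_simps)
  have diff: "p (Suc i) - p i = c *\<^sub>R (v - u)" for i
    by (simp add: p_def algebra_simps)
  have ends: "p 0 = u" "p N = v"
    using c by (simp_all add: p_def)
  \<comment> \<open>After division by \<open>c\<close> the quadratic term keeps one factor
    \<open>c\<close>, so its \<open>N\<close> copies add up to
    \<open>L * (norm e)\<^sup>2\<close>.\<close>
  have piece: "2 * ((g (p (Suc i)) - g (p i)) \<bullet> e) - L * c * (norm e)\<^sup>2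
      \<le> (g (p (Suc i)) - g (p i)) \<bullet> (v - u)" if "i < N" for i
  proof -
    have "2 * ((g (p (Suc i)) - g (p i)) \<bullet> (c *\<^sub>R e)) - L * (norm (c *\<^sub>R e))\<^sup>2
        \<le> (g (p (Suc i)) - g (p i)) \<bullet> (p (Suc i) - p i)"
      using mem[OF seg, of i] mem[OF seg, of "Suc i"] that
      by (intro convex_lipschitz_gradient_local[OF X conv d lip]) (auto simp: c_def)
    then have "c * (2 * ((g (p (Suc i)) - g (p i)) \<bullet> e) - L * c * (norm e)\<^sup>2)
        \<le> c * ((g (p (Suc i)) - g (p i)) \<bullet> (v - u))"
      unfolding diff by (simp add: power_mult_distrib algebra_simps power2_eq_square)
    with c(1) show ?thesis
      by simp
  qed
  have "(\<Sum>i<N. 2 * ((g (p (Suc i)) - g (p i)) \<bullet> e) - L * c * (norm e)\<^sup>2)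
      \<le> (\<Sum>i<N. (g (p (Suc i)) - g (p i)) \<bullet> (v - u))"
    by (intro sum_mono piece) simp
  moreover have "(\<Sum>i<N. g (p (Suc i)) - g (p i)) = g v - g u"
    using sum_lessThan_telescope[of "\<lambda>i. g (p i)" N] ends by simp
  then have "(\<Sum>i<N. (g (p (Suc i)) - g (p i)) \<bullet> h) = (g v - g u) \<bullet> h" for h
    by (simp flip: inner_sum_left)
  moreover have "real N * (L * c * (norm e)\<^sup>2) = L * (norm e)\<^sup>2"
    using c(2) by (metis mult.assoc mult.left_commute mult_1)
  ultimately show ?thesis
    by (simp add: sum_subtractf flip: sum_distrib_left)
qed

text \<open>On all of space this is cocoercivity of the gradient followed by Young's inequality. On a
  set \<open>X\<close> that may have empty interior, the segment \<open>[a, b]\<close> is first moved towards the centroid of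
  the triangle \<open>a, b, z\<close>, where short excursions in the plane of the triangle remain in \<open>X\<close>.\<close>

lemma convex_lipschitz_gradient_three_point:
  fixes \<phi> :: "'a::euclidean_space \<Rightarrow> real"
  assumes X: "convex X" and conv: "convex_on X \<phi>"
    and d: "\<And>u. u \<in> X \<Longrightarrow> GDERIV \<phi> u :> g u"
    and lip: "\<And>u v. u \<in> X \<Longrightarrow> v \<in> X \<Longrightarrow> norm (g u - g v) \<le> L * norm (u - v)"
    and mem: "a \<in> X" "b \<in> X" "z \<in> X"
  shows "- (L / 4) * (norm ((z - b) - (b - a)))\<^sup>2 \<le> (g b - g a) \<bullet> (z - b)"
proof -
  \<comment> \<open>This choice turns \<open>2 * ((g b - g a) \<bullet> e)\<close> into the pairing
    with \<open>b - a\<close>, which cancels against the right-hand side, minus the pairing with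
    \<open>z - b\<close>, which is the one to be bounded.\<close>
  define e where "e = (1/2) *\<^sub>R ((b - a) - (z - b))"
  define c where "c = (1/3) *\<^sub>R a + (1/3) *\<^sub>R b + (1/3) *\<^sub>R z"
  define \<epsilon> where "\<epsilon> n = inverse (real (Suc n))" for n
  have \<epsilon>: "0 < \<epsilon> n" "\<epsilon> n \<le> 1" for n
    by (auto simp: \<epsilon>_def field_simps)
  have tri: "i *\<^sub>R a + j *\<^sub>R b + k *\<^sub>R z \<in> X" if "0 \<le> i" "0 \<le> j" "0 \<le> k" "i + j + k = 1" for i j k
    using convex_sum[of "{0::nat,1,2}" X "(\<lambda>_. 0)(0 := i, 1 := j, 2 := k)"
        "(\<lambda>_. a)(1 := b, 2 := z)"] X that mem by (simp add: add.assoc)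
  have c: "c \<in> X"
    unfolding c_def by (rule tri) auto
  \<comment> \<open>The factor 1/3 is the largest for which all barycentric coordinates of both
    points stay nonnegative: that of \<open>b\<close> in the second point is 0.\<close>
  have ce: "c + (1/3) *\<^sub>R e \<in> X" "c - (1/3) *\<^sub>R e \<in> X"
  proof -
    have "c + (1/3) *\<^sub>R e = (1/6) *\<^sub>R a + (2/3) *\<^sub>R b + (1/6) *\<^sub>R z"
      "c - (1/3) *\<^sub>R e = (1/2) *\<^sub>R a + 0 *\<^sub>R b + (1/2) *\<^sub>R z"
      by (rule euclidean_eqI, simp add: c_def e_def inner_simps field_simps)+
    then show "c + (1/3) *\<^sub>R e \<in> X" "c - (1/3) *\<^sub>R e \<in> X"
      by (auto simp only: intro!: tri)
  qed
  \<comment> \<open>The contraction towards \<open>c\<close> makes room for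
    \<open>\<epsilon> n / 3\<close> times \<open>e\<close> on both sides of every image point; this
    fixes the number \<open>3 * Suc n\<close> of pieces.\<close>
  define m where "m n w = (1 - \<epsilon> n) *\<^sub>R w + \<epsilon> n *\<^sub>R c" for n w
  have m: "m n w \<in> X" if "w \<in> X" for n w
    unfolding m_def using X that c \<epsilon>[of n] by (intro convexD) auto
  have ineq: "2 * ((g (m n b) - g (m n a)) \<bullet> e) - L * (norm e)\<^sup>2
      \<le> (g (m n b) - g (m n a)) \<bullet> (m n b - m n a)" for n
  proof (rule convex_lipschitz_gradient_segment[OF X conv d lip, where N = "3 * Suc n"])
    fix w
    assume "w \<in> closed_segment (m n a) (m n b)"
    then obtain t where t: "0 \<le> t" "t \<le> 1" and w: "w = (1 - t) *\<^sub>R m n a + t *\<^sub>R m n b"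
      by (auto simp: closed_segment_def)
    define w' where "w' = (1 - t) *\<^sub>R a + t *\<^sub>R b"
    have w': "w' \<in> X"
      unfolding w'_def using X mem t by (intro convexD) auto
    have w_eq: "w = m n w'"
      by (simp add: w w'_def m_def algebra_simps)
    have scale: "1 / real (3 * Suc n) = \<epsilon> n * (1/3)"
      by (simp add: \<epsilon>_def field_simps)
    have "w + (\<epsilon> n * (1/3)) *\<^sub>R e = (1 - \<epsilon> n) *\<^sub>R w' + \<epsilon> n *\<^sub>R (c + (1/3) *\<^sub>R e)"
      "w - (\<epsilon> n * (1/3)) *\<^sub>R e = (1 - \<epsilon> n) *\<^sub>R w' + \<epsilon> n *\<^sub>R (c - (1/3) *\<^sub>R e)"
      by (simp_all add: w_eq m_def algebra_simps)
    then show "w \<in> X \<and> w + (1 / real (3 * Suc n)) *\<^sub>R e \<in> X \<and> w - (1 / real (3 * Suc n)) *\<^sub>R e \<in> X"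
      unfolding scale using m[OF w'] w' ce X \<epsilon>[of n] by (auto simp: w_eq intro!: convexD)
  qed auto
  have lim0: "\<epsilon> \<longlonglongrightarrow> 0"
    unfolding \<epsilon>_def by (rule LIMSEQ_inverse_real_of_nat)
  have lim_m: "(\<lambda>n. m n w) \<longlonglongrightarrow> w" for w
    unfolding m_def using lim0 by (auto intro!: tendsto_eq_intros)
  \<comment> \<open>Continuity of \<open>g\<close> on \<open>X\<close> lets the inequality pass to
    the limit as the contracted segment returns to the original one. The absolute value supplies the
    nonnegative constant that \<open>lipschitz_on\<close> demands.\<close>
  have "\<bar>L\<bar>-lipschitz_on X g"
    by (intro lipschitz_onI)
      (auto simp: dist_norm intro: order_trans[OF lip mult_right_mono])
  then have cont: "continuous_on X g"
    by (rule lipschitz_on_continuous_on)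
  have lim_g: "(\<lambda>n. g (m n w)) \<longlonglongrightarrow> g w" if "w \<in> X" for w
    using cont lim_m that m by (intro continuous_on_tendsto_compose[of X g]) auto
  have "(\<lambda>n. 2 * ((g (m n b) - g (m n a)) \<bullet> e) - L * (norm e)\<^sup>2)
      \<longlonglongrightarrow> 2 * ((g b - g a) \<bullet> e) - L * (norm e)\<^sup>2"
    by (intro tendsto_intros lim_g mem)
  moreover have "(\<lambda>n. (g (m n b) - g (m n a)) \<bullet> (m n b - m n a)) \<longlonglongrightarrow> (g b - g a) \<bullet> (b - a)"
    by (intro tendsto_intros lim_g lim_m mem)
  ultimately have "2 * ((g b - g a) \<bullet> e) - L * (norm e)\<^sup>2 \<le> (g b - g a) \<bullet> (b - a)"
    using ineq by (intro LIMSEQ_le) auto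
  moreover have "(norm e)\<^sup>2 = (norm ((z - b) - (b - a)))\<^sup>2 / 4"
    by (simp add: e_def norm_minus_commute power_divide)
  moreover have "2 * ((g b - g a) \<bullet> e) = (g b - g a) \<bullet> (b - a) - (g b - g a) \<bullet> (z - b)"
    by (simp add: e_def inner_diff_right)
  ultimately show ?thesis
    by simp
qed

section \<open>Existence of the partial gradients\<close>

text \<open>The gradients are definite descriptions, so they carry information only once existence
  is known. It follows from the joint derivative by the chain rule; \<open>adjoint A 1\<close> is
  the Riesz representative of the functional \<open>A\<close>.\<close>

lemma smooth_on_nhd_GDERIV:
  assumes "smooth_on_nhd f S" and "(u, v) \<in> S"
  shows "GDERIV (\<lambda>u. f u v) u :> grad_x f u v" and "GDERIV (\<lambda>v. f u v) v :> grad_y f u v"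
proof -
  obtain D :: "'a \<times> 'b \<Rightarrow> ('a \<times> 'b) \<Rightarrow>\<^sub>L real"
    where D: "((\<lambda>(x, y). f x y) has_derivative blinfun_apply (D (u, v))) (at (u, v))"
    using assms unfolding smooth_on_nhd_def by blast
  have repr: "GDERIV h w :> adjoint A 1"
    if "(h has_derivative A) (at w)" for h :: "'c::euclidean_space \<Rightarrow> real" and A w
  proof -
    have "A k = k \<bullet> adjoint A 1" for k
      using adjoint_works[OF has_derivative_linear[OF that], of k 1] by simp
    then have "A = (\<lambda>k. k \<bullet> adjoint A 1)" ..
    with that show ?thesis
      unfolding gderiv_def by metis
  qed
  have "((\<lambda>u. (u, v)) has_derivative (\<lambda>h. (h, 0))) (at u)"
    by (auto intro!: derivative_eq_intros)
  from repr[OF has_derivative_compose[OF this D]]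
  show "GDERIV (\<lambda>u. f u v) u :> grad_x f u v"
    using gradient_eqI by (fastforce simp: grad_x_def)
  have "((\<lambda>v. (u, v)) has_derivative (\<lambda>h. (0, h))) (at v)"
    by (auto intro!: derivative_eq_intros)
  from repr[OF has_derivative_compose[OF this D]]
  show "GDERIV (\<lambda>v. f u v) v :> grad_y f u v"
    using gradient_eqI by (fastforce simp: grad_y_def)
qed

section \<open>Growth of the potential in one iteration\<close>

theorem lemma4p4:
  fixes f :: "real ^ 'n \<Rightarrow> real ^ 'm \<Rightarrow> real"
    and X :: "(real ^ 'n) set" and Y :: "(real ^ 'm) set"
    and L11 L12 L21 L22 L11' \<zeta> \<nu> :: real
    and q \<gamma> S F :: "nat \<Rightarrow> real"
    and x :: "nat \<Rightarrow> real ^ 'n" and y :: "nat \<Rightarrow> real ^ 'm"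
  assumes X: "X \<noteq> {}" "closed X" "bounded X" "convex X"
    and Y: "Y \<noteq> {}" "closed Y" "bounded Y" "convex Y"
    and smooth: "smooth_on_nhd f (X \<times> Y)"
    and convex_f: "\<And>v. v \<in> Y \<Longrightarrow> convex_on X (\<lambda>u. f u v)"
    and L_pos: "L11 > 0" "L12 > 0" "L21 > 0" "L22 > 0"
    and lipschitz: "lipschitz_gradients f X Y L11 L12 L21 L22"
    and q_pos: "\<And>k. k \<ge> 1 \<Longrightarrow> q k > 0"
    and q_decreasing: "\<And>k. k \<ge> 1 \<Longrightarrow> q (k + 1) \<le> q k"
    and \<zeta>_pos: "\<zeta> > 0" and \<nu>_pos: "\<nu> > 0"
    and start: "x 1 \<in> X" "y 1 \<in> Y"
    and x_step: "\<And>k. k \<ge> 1 \<Longrightarrow>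
      x (k + 1) = closest_point X (x k - \<zeta> *\<^sub>R grad_x f (x k) (y k) - (\<zeta> * q k) *\<^sub>R x k)"
    and y_step: "\<And>k. k \<ge> 1 \<Longrightarrow>
      y (k + 1) = closest_point Y (y k + (1 / (\<nu> + \<gamma> k)) *\<^sub>R grad_y f (x (k + 1)) (y k))"
    and L11'_def: "L11' = L11 + q 1"
    and S_def: "\<And>k. k \<ge> 1 \<Longrightarrow>
      S (k + 1) = - (8 / (\<zeta>\<^sup>2 * q (k + 1))) * (norm (x (k + 1) - x k))\<^sup>2
        - (8 / \<zeta>) * (1 - q k / q (k + 1)) * (norm (x (k + 1)))\<^sup>2"
    and F_def: "\<And>k. k \<ge> 1 \<Longrightarrow>
      F (k + 1) = f (x (k + 1)) (y (k + 1)) + S (k + 1)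
        + (15 / (2 * \<zeta>)) * (norm (x (k + 1) - x k))\<^sup>2
        + (q k / 2) * (norm (x (k + 1)))\<^sup>2
        - (\<zeta> * L21\<^sup>2 / 2 + 16 * L21\<^sup>2 / (\<zeta> * (q (k + 1))\<^sup>2)) * (norm (y (k + 1) - y k))\<^sup>2"
    and \<gamma>_gt: "\<And>k. k \<ge> 1 \<Longrightarrow> \<gamma> k > L22"
    and q_rate: "\<And>k. k \<ge> 1 \<Longrightarrow> 1 / q (k + 1) - 1 / q k \<le> \<zeta> / 5"
    and \<zeta>_le: "\<zeta> \<le> 2 / (L11' + q 1)"
  shows "\<forall>k\<ge>2.
      F (k + 1) - F k \<ge>
        (\<nu> + \<gamma> k / 2 - \<zeta> * L21\<^sup>2 / 2 - 16 * L21\<^sup>2 / (\<zeta> * (q (k + 1))\<^sup>2)) * (norm (y (k + 1) - y k))\<^sup>2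
        + ((q k - q (k - 1)) / 2) * (norm (x (k + 1)))\<^sup>2
        + (9 / (10 * \<zeta>)) * (norm (x (k + 1) - x k))\<^sup>2
        + (8 / \<zeta>) * (q k / q (k + 1) - q (k - 1) / q k) * (norm (x (k + 1)))\<^sup>2"
proof (intro allI impI)
  fix k :: nat
  assume k: "k \<ge> 2"
  \<comment> \<open>As \<open>k \<ge> 2\<close>, the index \<open>j\<close> is at least 1, so the
    recursions and the definitions of \<open>S\<close> and \<open>F\<close> also apply one step
    earlier.\<close>
  define j where "j = k - 1"
  have j: "j \<ge> 1" "k = j + 1" "k \<ge> 1"
    using k by (auto simp: j_def)
  have xX: "x i \<in> X" if "i \<ge> 1" for i
    using that
  proof (cases "i = 1")
    case False
    then have "x (i - 1 + 1) \<in> X"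
      using that X by (subst x_step) (auto intro: closest_point_in_set)
    with that show ?thesis by simp
  qed (use start in simp)
  have yY: "y i \<in> Y" if "i \<ge> 1" for i
    using that
  proof (cases "i = 1")
    case False
    then have "y (i - 1 + 1) \<in> Y"
      using that Y by (subst y_step) (auto intro: closest_point_in_set)
    with that show ?thesis by simp
  qed (use start in simp)
  note derx = smooth_on_nhd_GDERIV(1)[OF smooth] and dery = smooth_on_nhd_GDERIV(2)[OF smooth]
  define s d p r where "s = x k - x j" and "d = x (k + 1) - x k"
    and "p = y k - y j" and "r = y (k + 1) - y k"
  \<comment> \<open>The current gradient is \<open>G + \<Gamma> + \<Delta>\<close>: the previous
    one, the change due to \<open>y\<close>, controlled by \<open>L21\<close>, and the change due to
    \<open>x\<close> at fixed \<open>y j\<close>, to which the three-point estimate applies.\<close>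
  define \<Gamma> where "\<Gamma> = grad_x f (x k) (y k) - grad_x f (x k) (y j)"
  define \<Delta> where "\<Delta> = grad_x f (x k) (y j) - grad_x f (x j) (y j)"
  define G where "G = grad_x f (x j) (y j)"
  have mem: "x j \<in> X" "x k \<in> X" "x (k + 1) \<in> X" "y j \<in> Y" "y k \<in> Y" "y (k + 1) \<in> Y"
    using xX yY j by auto
  have qs: "q j > 0" "q k > 0" "q (k + 1) > 0" "q k \<le> q j"
    using q_pos q_decreasing[of j] j by auto
  have q1: "q i \<le> q 1" if "i \<ge> 1" for i
    using that by (induction i rule: dec_induct) (use q_decreasing order_trans in fastforce)+
  have \<Gamma>: "norm \<Gamma> \<le> L21 * norm p"
    using lipschitz mem unfolding lipschitz_gradients_def \<Gamma>_def p_def by blast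

  have proj_prev: "(s + \<zeta> *\<^sub>R (G + q j *\<^sub>R x j)) \<bullet> d \<ge> 0"
    using closest_point_dot[OF X(4,2) mem(3),
        of "x j - \<zeta> *\<^sub>R grad_x f (x j) (y j) - (\<zeta> * q j) *\<^sub>R x j"]
    unfolding x_step[OF j(1), folded j(2), symmetric]
    by (simp add: s_def d_def G_def inner_diff_left inner_diff_right inner_add_left algebra_simps)
  have proj_cur: "(d + \<zeta> *\<^sub>R (G + \<Gamma> + \<Delta> + q k *\<^sub>R x k)) \<bullet> d \<le> 0"
    using closest_point_dot[OF X(4,2) mem(2),
        of "x k - \<zeta> *\<^sub>R grad_x f (x k) (y k) - (\<zeta> * q k) *\<^sub>R x k"]
    unfolding x_step[OF j(3), symmetric]
    by (simp add: d_def G_def \<Gamma>_def \<Delta>_def inner_diff_left inner_diff_right inner_add_left algebra_simps)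

  have "- (L11 / 4) * (norm (d - s))\<^sup>2 \<le> \<Delta> \<bullet> d"
    unfolding d_def s_def \<Delta>_def
    by (rule convex_lipschitz_gradient_three_point[OF X(4) convex_f[OF mem(4)]])
      (use lipschitz mem in \<open>auto intro!: derx simp: lipschitz_gradients_def\<close>)
  \<comment> \<open>A quarter of the step size condition, since \<open>q j \<le> q 1\<close>. The
    summand \<open>q j / 2\<close> comes from polarising \<open>q j * (s \<bullet> d)\<close>, the
    contribution of the regularisation.\<close>
  moreover have "L11 / 4 + q j / 2 \<le> 1 / (2 * \<zeta>)"
  proof -
    have "L11 / 4 + q 1 / 2 \<le> 1 / (2 * \<zeta>)"
      using \<zeta>_le \<zeta>_pos L_pos(1) q_pos[of 1] unfolding L11'_def by (simp add: field_simps)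
    with q1[OF j(1)] show ?thesis by simp
  qed
  then have "(L11 / 4 + q j / 2) * (norm (d - s))\<^sup>2 \<le> 1 / (2 * \<zeta>) * (norm (d - s))\<^sup>2"
    by (rule mult_right_mono) simp
  moreover have sd: "s \<bullet> d = ((norm s)\<^sup>2 + (norm d)\<^sup>2 - (norm (d - s))\<^sup>2) / 2"
    by (simp add: power2_norm_eq_inner inner_diff_left inner_diff_right inner_commute)
  then have "q j * (s \<bullet> d) = q j / 2 * ((norm s)\<^sup>2 + (norm d)\<^sup>2) - q j / 2 * (norm (d - s))\<^sup>2"
    by (simp add: right_diff_distrib diff_divide_distrib)
  ultimately have \<Delta>: "\<Delta> \<bullet> d + q j * (s \<bullet> d)
      \<ge> - (1 / (2 * \<zeta>)) * (norm (d - s))\<^sup>2 + q j / 2 * ((norm s)\<^sup>2 + (norm d)\<^sup>2)"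
    by (simp add: distrib_right)

  have xd: "x k \<bullet> d = ((norm (x (k + 1)))\<^sup>2 - (norm (x k))\<^sup>2 - (norm d)\<^sup>2) / 2"
    by (simp add: d_def power2_norm_eq_inner inner_diff_left inner_diff_right inner_commute)
  have xjd: "x j \<bullet> d = x k \<bullet> d - s \<bullet> d"
    by (simp add: s_def inner_diff_left)

  have f_x: "(G + \<Gamma> + \<Delta>) \<bullet> d \<le> f (x (k + 1)) (y k) - f (x k) (y k)"
    using convex_on_gradient_ineq[OF convex_f[OF mem(5)] derx mem(2,3)] mem
    by (simp add: G_def \<Gamma>_def \<Delta>_def d_def)

  \<comment> \<open>The projection gains \<open>\<nu> + \<gamma> k\<close>, and the curvature in
    \<open>y\<close> costs at most \<open>L22 / 2\<close>, which is below
    \<open>\<gamma> k / 2\<close>.\<close>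
  have f_y: "(\<nu> + \<gamma> k / 2) * (norm r)\<^sup>2 \<le> f (x (k + 1)) (y (k + 1)) - f (x (k + 1)) (y k)"
  proof -
    define g where "g = grad_y f (x (k + 1)) (y k)"
    have pos: "\<nu> + \<gamma> k > 0"
      using \<nu>_pos \<gamma>_gt[OF j(3)] L_pos by simp
    have "((1 / (\<nu> + \<gamma> k)) *\<^sub>R g - r) \<bullet> r \<ge> 0"
      using closest_point_dot[OF Y(4,2) mem(5), of "y k + (1 / (\<nu> + \<gamma> k)) *\<^sub>R g"]
      unfolding g_def y_step[OF j(3), symmetric]
      by (simp add: r_def inner_diff_left inner_diff_right inner_add_left algebra_simps)
    then have "g \<bullet> r \<ge> (\<nu> + \<gamma> k) * (norm r)\<^sup>2"
      using pos by (simp add: inner_diff_left power2_norm_eq_inner field_simps)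
    moreover have "f (x (k + 1)) (y k) + g \<bullet> r - L22 / 2 * (norm r)\<^sup>2 \<le> f (x (k + 1)) (y (k + 1))"
      unfolding g_def r_def
      by (rule lipschitz_gradient_lower_bound[OF Y(4)])
        (use lipschitz mem in \<open>auto intro!: dery simp: lipschitz_gradients_def\<close>)
    moreover have "L22 / 2 * (norm r)\<^sup>2 \<le> \<gamma> k / 2 * (norm r)\<^sup>2"
      using \<gamma>_gt[OF j(3)] by (intro mult_right_mono) auto
    ultimately show ?thesis
      by (simp add: algebra_simps)
  qed

  define a b where "a = (norm (x (k + 1)))\<^sup>2" and "b = (norm (x k))\<^sup>2"
  \<comment> \<open>The weight \<open>\<zeta> / 2\<close> will produce the first \<open>L21\<close>
    term of \<open>F\<close>, the weight \<open>1 / q k\<close> the second.\<close>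
  have young: "- (c * L21\<^sup>2 * (norm p)\<^sup>2 + (norm d)\<^sup>2 / (4 * c)) \<le> \<Gamma> \<bullet> d" if "c > 0" for c
  proof -
    have "- (\<Gamma> \<bullet> d) \<le> norm \<Gamma> * norm d"
      using norm_cauchy_schwarz[of "- \<Gamma>" d] by simp
    also have "\<dots> \<le> (L21 * norm p) * norm d"
      using \<Gamma> by (rule mult_right_mono) simp
    also have "\<dots> \<le> c * L21\<^sup>2 * (norm p)\<^sup>2 + (norm d)\<^sup>2 / (4 * c)"
    proof -
      have "0 \<le> (2 * c * (L21 * norm p) - norm d)\<^sup>2 / (4 * c)"
        using that by simp
      also have "\<dots> = c * L21\<^sup>2 * (norm p)\<^sup>2 + (norm d)\<^sup>2 / (4 * c) - (L21 * norm p) * norm d"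
        using that by (simp add: field_simps power2_eq_square)
      finally show ?thesis by simp
    qed
    finally show ?thesis by simp
  qed

  \<comment> \<open>\<open>proj_prev\<close> bounds the pairing of \<open>d\<close> with
    \<open>G\<close>, \<open>\<Delta>\<close> and \<open>young\<close> bound the rest. By
    polarisation the mixed terms leave the halves of \<open>(norm s)\<^sup>2 / \<zeta>\<close> and
    \<open>(norm d)\<^sup>2 / \<zeta>\<close>; Young's inequality costs the other half of the
    latter.\<close>
  have x_part: "f (x (k + 1)) (y k) - f (x k) (y k) + q k / 2 * a - q j / 2 * b
      \<ge> (q k - q j) / 2 * a - (norm s)\<^sup>2 / (2 * \<zeta>) - (norm d)\<^sup>2 / \<zeta>
        - \<zeta> * L21\<^sup>2 / 2 * (norm p)\<^sup>2"
  proof -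
    have "- (s \<bullet> d) / \<zeta> \<le> G \<bullet> d + q j * (x j \<bullet> d)"
      using proj_prev \<zeta>_pos by (simp add: inner_add_left field_simps)
    moreover have "- (\<zeta> * L21\<^sup>2 / 2 * (norm p)\<^sup>2) - (norm d)\<^sup>2 / (2 * \<zeta>) \<le> \<Gamma> \<bullet> d"
      using young[of "\<zeta> / 2"] \<zeta>_pos by simp
    moreover have "q j / 2 * ((norm s)\<^sup>2 + (norm d)\<^sup>2) \<ge> 0"
      using qs by simp
    moreover have "q j * (x j \<bullet> d) = q j * (x k \<bullet> d) - q j * (s \<bullet> d)"
      by (simp add: xjd algebra_simps)
    moreover have "q j * (x k \<bullet> d) = q j / 2 * a - q j / 2 * b - q j / 2 * (norm d)\<^sup>2"
      by (simp add: xd a_def b_def field_simps)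
    moreover have "- (s \<bullet> d) / \<zeta> - (1 / (2 * \<zeta>)) * (norm (d - s))\<^sup>2
        = - (norm s)\<^sup>2 / (2 * \<zeta>) - (norm d)\<^sup>2 / (2 * \<zeta>) "
      unfolding sd using \<zeta>_pos by (simp add: field_simps)
    moreover have "(norm d)\<^sup>2 / \<zeta> = (norm d)\<^sup>2 / (2 * \<zeta>) + (norm d)\<^sup>2 / (2 * \<zeta>)"
      by simp
    moreover have "(q k - q j) / 2 * a = q k / 2 * a - q j / 2 * a"
      by (simp add: field_simps)
    moreover have "q j / 2 * (norm d)\<^sup>2 \<ge> 0"
      using qs by simp
    ultimately show ?thesis
      using f_x \<Delta> by (simp only: inner_add_left)
  qed

  have S_part: "S (k + 1) - S k \<ge> 8 / \<zeta> * (norm s)\<^sup>2 + 12 / (5 * \<zeta>) * (norm d)\<^sup>2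
      - 16 * L21\<^sup>2 / (\<zeta> * (q k)\<^sup>2) * (norm p)\<^sup>2
      + 8 / \<zeta> * (q k / q (k + 1) - q j / q k) * a"
  proof -
    \<comment> \<open>The difference of the two projection inequalities, with
      \<open>q k *\<^sub>R x k - q j *\<^sub>R x j\<close> written as
      \<open>(q k - q j) *\<^sub>R x k + q j *\<^sub>R s\<close>.\<close>
    have "(d - s) \<bullet> d + \<zeta> * (\<Gamma> \<bullet> d + (\<Delta> \<bullet> d + q j * (s \<bullet> d)) + (q k - q j) * (x k \<bullet> d)) \<le> 0"
      using proj_prev proj_cur
      by (simp add: xjd inner_add_left inner_diff_left algebra_simps)
    moreover have "\<zeta> * (- (1 / (2 * \<zeta>)) * (norm (d - s))\<^sup>2 + q j / 2 * ((norm s)\<^sup>2 + (norm d)\<^sup>2))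
        \<le> \<zeta> * (\<Delta> \<bullet> d + q j * (s \<bullet> d))"
      using \<Delta> \<zeta>_pos by (intro mult_left_mono) auto
    moreover have "\<zeta> * (- (1 / (2 * \<zeta>)) * (norm (d - s))\<^sup>2 + q j / 2 * ((norm s)\<^sup>2 + (norm d)\<^sup>2))
        = - (norm (d - s))\<^sup>2 / 2 + \<zeta> * q j * ((norm s)\<^sup>2 + (norm d)\<^sup>2) / 2"
      using \<zeta>_pos by (simp add: field_simps)
    moreover have "\<zeta> * ((q k - q j) * (x k \<bullet> d))
        = (\<zeta> * (q k - q j) * (a - b) + \<zeta> * ((q j - q k) * (norm d)\<^sup>2)) / 2"
      by (simp add: xd a_def b_def algebra_simps add_divide_distrib diff_divide_distrib)
    moreover have "(d - s) \<bullet> d = ((norm d)\<^sup>2 - (norm s)\<^sup>2 + (norm (d - s))\<^sup>2) / 2"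
      by (simp add: inner_diff_left sd power2_norm_eq_inner[of d] field_simps)
    moreover have "\<zeta> * ((q j - q k) * (norm d)\<^sup>2) \<ge> 0"
      using qs \<zeta>_pos by simp
    ultimately have "\<zeta> * q j * ((norm s)\<^sup>2 + (norm d)\<^sup>2) + 2 * \<zeta> * (\<Gamma> \<bullet> d)
        + \<zeta> * (q k - q j) * (a - b) \<le> (norm s)\<^sup>2 - (norm d)\<^sup>2"
      unfolding distrib_left[of \<zeta>] by argo
    \<comment> \<open>The factor is, up to sign, the coefficient of \<open>(norm s)\<^sup>2\<close>
      in \<open>S k\<close>.\<close>
    then have "8 / (\<zeta>\<^sup>2 * q k) * (\<zeta> * q j * ((norm s)\<^sup>2 + (norm d)\<^sup>2) + 2 * \<zeta> * (\<Gamma> \<bullet> d)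
        + \<zeta> * (q k - q j) * (a - b)) \<le> 8 / (\<zeta>\<^sup>2 * q k) * ((norm s)\<^sup>2 - (norm d)\<^sup>2)"
      using \<zeta>_pos qs by (intro mult_left_mono) auto
    moreover have "8 / (\<zeta>\<^sup>2 * q k) * (\<zeta> * q j * ((norm s)\<^sup>2 + (norm d)\<^sup>2) + 2 * \<zeta> * (\<Gamma> \<bullet> d)
        + \<zeta> * (q k - q j) * (a - b)) = 8 / \<zeta> * (q j / q k) * ((norm s)\<^sup>2 + (norm d)\<^sup>2)
        + 16 / (\<zeta> * q k) * (\<Gamma> \<bullet> d) + 8 / \<zeta> * (1 - q j / q k) * (a - b)"
      using \<zeta>_pos qs by (simp add: field_simps power2_eq_square)
    moreover have "8 / \<zeta> * 1 * ((norm s)\<^sup>2 + (norm d)\<^sup>2)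
        \<le> 8 / \<zeta> * (q j / q k) * ((norm s)\<^sup>2 + (norm d)\<^sup>2)"
      using \<zeta>_pos qs by (intro mult_right_mono mult_left_mono) auto
    moreover have "16 / (\<zeta> * q k) * - (1 / q k * L21\<^sup>2 * (norm p)\<^sup>2 + (norm d)\<^sup>2 / (4 * (1 / q k)))
        \<le> 16 / (\<zeta> * q k) * (\<Gamma> \<bullet> d)"
      using young[of "1 / q k"] \<zeta>_pos qs by (intro mult_left_mono) auto
    moreover have "16 / (\<zeta> * q k) * - (1 / q k * L21\<^sup>2 * (norm p)\<^sup>2 + (norm d)\<^sup>2 / (4 * (1 / q k)))
        = - (16 * L21\<^sup>2 / (\<zeta> * (q k)\<^sup>2) * (norm p)\<^sup>2) - 4 / \<zeta> * (norm d)\<^sup>2"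
      using \<zeta>_pos qs by (simp add: field_simps power2_eq_square)
    moreover have "8 / \<zeta>\<^sup>2 * (1 / q (k + 1) - 1 / q k) * (norm d)\<^sup>2 \<le> 8 / \<zeta>\<^sup>2 * (\<zeta> / 5) * (norm d)\<^sup>2"
      using q_rate[OF j(3)] by (intro mult_right_mono mult_left_mono) auto
    moreover have "8 / \<zeta>\<^sup>2 * (\<zeta> / 5) * (norm d)\<^sup>2 = 8 / (5 * \<zeta>) * (norm d)\<^sup>2"
      using \<zeta>_pos by (simp add: field_simps power2_eq_square)
    moreover have "S (k + 1) - S k = 8 / (\<zeta>\<^sup>2 * q k) * ((norm s)\<^sup>2 - (norm d)\<^sup>2)
        - 8 / \<zeta>\<^sup>2 * (1 / q (k + 1) - 1 / q k) * (norm d)\<^sup>2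
        - 8 / \<zeta> * (1 - q k / q (k + 1)) * a + 8 / \<zeta> * (1 - q j / q k) * b"
      using S_def[OF j(3)] S_def[OF j(1), folded j(2)]
      by (simp add: d_def s_def a_def b_def algebra_simps diff_divide_distrib)
    \<comment> \<open>In units of \<open>1 / \<zeta>\<close>, the balance for
      \<open>(norm d)\<^sup>2\<close> is 8 - 4 - 8/5 = 12/5: the gain, the loss in Young's
      inequality, and the loss from the decrease of \<open>q\<close>.\<close>
    moreover have "8 / \<zeta> * (norm s)\<^sup>2 + 12 / (5 * \<zeta>) * (norm d)\<^sup>2
        = 8 / \<zeta> * 1 * ((norm s)\<^sup>2 + (norm d)\<^sup>2) - 4 / \<zeta> * (norm d)\<^sup>2 - 8 / (5 * \<zeta>) * (norm d)\<^sup>2"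
      using \<zeta>_pos by (simp add: field_simps)
    moreover have "8 / \<zeta> * (q k / q (k + 1) - q j / q k) * a
        = 8 / \<zeta> * (1 - q j / q k) * (a - b) - 8 / \<zeta> * (1 - q k / q (k + 1)) * a
          + 8 / \<zeta> * (1 - q j / q k) * b"
      by (simp add: algebra_simps add_divide_distrib diff_divide_distrib)
    ultimately show ?thesis
      by argo
  qed

  \<comment> \<open>The weight of the squared \<open>y\<close> step in \<open>F\<close>.
    \<open>C k\<close> pays exactly for the two Young losses in \<open>(norm p)\<^sup>2\<close>, and
    \<open>C (k + 1)\<close> is charged to the gain \<open>f_y\<close>. The
    \<open>(norm s)\<^sup>2\<close> terms cancel as well, because 8 - 1/2 = 15/2.\<close>
  define C where "C i = \<zeta> * L21\<^sup>2 / 2 + 16 * L21\<^sup>2 / (\<zeta> * (q i)\<^sup>2)" for i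
  have "F (k + 1) - F k = (f (x (k + 1)) (y (k + 1)) - f (x (k + 1)) (y k))
      + (f (x (k + 1)) (y k) - f (x k) (y k) + q k / 2 * a - q j / 2 * b) + (S (k + 1) - S k)
      + 15 / (2 * \<zeta>) * (norm d)\<^sup>2 - 15 / (2 * \<zeta>) * (norm s)\<^sup>2
      - C (k + 1) * (norm r)\<^sup>2 + C k * (norm p)\<^sup>2"
    using F_def[OF j(3)] F_def[OF j(1), folded j(2)]
    by (simp add: d_def s_def r_def p_def a_def b_def C_def)
  moreover have "8 / \<zeta> * (norm s)\<^sup>2 - (norm s)\<^sup>2 / (2 * \<zeta>) = 15 / (2 * \<zeta>) * (norm s)\<^sup>2"
    using \<zeta>_pos by (simp add: field_simps)
  moreover have "9 / (10 * \<zeta>) * (norm d)\<^sup>2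
      \<le> 12 / (5 * \<zeta>) * (norm d)\<^sup>2 - (norm d)\<^sup>2 / \<zeta> + 15 / (2 * \<zeta>) * (norm d)\<^sup>2"
    using \<zeta>_pos by (simp add: field_simps)
  moreover have "C k * (norm p)\<^sup>2
      = \<zeta> * L21\<^sup>2 / 2 * (norm p)\<^sup>2 + 16 * L21\<^sup>2 / (\<zeta> * (q k)\<^sup>2) * (norm p)\<^sup>2"
    by (simp add: C_def algebra_simps)
  moreover have "(\<nu> + \<gamma> k / 2 - \<zeta> * L21\<^sup>2 / 2 - 16 * L21\<^sup>2 / (\<zeta> * (q (k + 1))\<^sup>2)) * (norm r)\<^sup>2
      = (\<nu> + \<gamma> k / 2) * (norm r)\<^sup>2 - C (k + 1) * (norm r)\<^sup>2"
    by (simp add: C_def algebra_simps)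
  ultimately have "F (k + 1) - F k \<ge>
        (\<nu> + \<gamma> k / 2 - \<zeta> * L21\<^sup>2 / 2 - 16 * L21\<^sup>2 / (\<zeta> * (q (k + 1))\<^sup>2)) * (norm r)\<^sup>2
        + (q k - q j) / 2 * a + 9 / (10 * \<zeta>) * (norm d)\<^sup>2
        + 8 / \<zeta> * (q k / q (k + 1) - q j / q k) * a"
    using x_part S_part f_y by linarith
  then show "F (k + 1) - F k \<ge>
        (\<nu> + \<gamma> k / 2 - \<zeta> * L21\<^sup>2 / 2 - 16 * L21\<^sup>2 / (\<zeta> * (q (k + 1))\<^sup>2)) * (norm (y (k + 1) - y k))\<^sup>2
        + ((q k - q (k - 1)) / 2) * (norm (x (k + 1)))\<^sup>2
        + (9 / (10 * \<zeta>)) * (norm (x (k + 1) - x k))\<^sup>2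
        + (8 / \<zeta>) * (q k / q (k + 1) - q (k - 1) / q k) * (norm (x (k + 1)))\<^sup>2"
    by (simp only: r_def d_def a_def j_def)
qed

end
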